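(* Let $d\geq 2$, let $c_1,c_2>0$, and let $K$ be a convex body in $\mathbb{R}^{d}$ such that $$ \frac{1}{c_{1}}B_{2}^{d} \subset K \subset c_{2}B_{2}^{d}. $$ Let $0 < t \leq (5c_{1}c_{2}d)^{-d-1}\,\mathrm{vol}_{d}(K)$ and let $n \in \mathbb{N}$ with $$ \left(\frac{128}{7} \pi\right)^{\frac{d-1}{2}} \leq n \leq \frac{1}{32\, e\, d\, t}\,\mathrm{vol}_{d}(K^{t} \setminus K). $$ Then for every polytope $P_{n}$ that contains $K$ and has at most $n$ faces of dimension $d-1$, $$ \mathrm{vol}_{d}(K^{t} \setminus K) \leq 10^{7}\, d^{2}\,(c_{1}c_{2})^{2+\frac{1}{d-1}}\, \mathrm{vol}_{d}(P_{n} \setminus K). $$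
   Context: A convex body in $\mathbb{R}^d$ is a compact convex set with nonempty interior; $\mathrm{vol}_d$ is $d$-dimensional volume (Lebesgue measure); $B_2^d$ is the closed Euclidean unit ball of $\mathbb{R}^d$ centered at the origin. A polytope is the convex hull of finitely many points. In the bounds, $e$ is the base of the natural logarithm. For a convex body $K$ and $t\ge 0$, the illumination body $K^{t}$ of $K$ is $$ K^{t}=\{x \in \mathbb{R}^{d} \;|\; \mathrm{vol}_{d}([x,K] \setminus K) \leq t\}, $$ where $[x,K]$ denotes the convex hull of $\{x\}\cup K$. *)

theory Defs
  imports "HOL-Analysis.Analysis"
begin

(* Lebesgue (rather than Borel) measure, so that every bounded convex set is measurable. *)
abbreviation vol :: "(real ^ 'd) set \<Rightarrow> real" where
  "vol S \<equiv> measure lebesgue S"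

definition convex_body :: "(real ^ 'd) set \<Rightarrow> bool" where
  "convex_body K \<longleftrightarrow> compact K \<and> convex K \<and> interior K \<noteq> {}"

definition illumination_body :: "(real ^ 'd) set \<Rightarrow> real \<Rightarrow> (real ^ 'd) set" where
  "illumination_body K t = {x. vol ((convex hull (insert x K)) - K) \<le> t}"

end

theory Submission
  imports Defs
begin

text \<open>
  Write \<open>I\<close> for the illumination body \<open>K\<^sup>t\<close> and \<open>d\<close> for the dimension. The theorem follows from a
  stronger bound, in which \<open>12 d\<close> replaces the factor in front of \<open>vol (P - K)\<close>. The volume of
  \<open>I - K\<close> inside \<open>P\<close> is at most \<open>vol (P - K)\<close>, so only the part of \<open>I\<close> outside \<open>P\<close> has to be
  controlled. Each facet of \<open>P\<close> lies in a hyperplane \<open>a \<bullet> y = 1\<close>, and the facets divide the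
  space into cones with apex \<open>0\<close>, on each of which the functional of one facet is the largest. In
  the cone of one facet, the part of \<open>I\<close> beyond the hyperplane is compared with the part of
  \<open>P - K\<close> below it, as follows.

  Let \<open>x\<close> be a point of \<open>I\<close> in the cone that is, up to a factor 2, as high as possible above the
  hyperplane, and let \<open>a \<bullet> x = 1 + \<eta>\<close>. Consider the slab \<open>1 - \<eta> / d < a \<bullet> y \<le> 1\<close> directly below
  the hyperplane.

  \<^item> The slab contains little of \<open>K\<close>: the homothety with centre \<open>x\<close> and ratio \<open>d / (d + 1)\<close> moves
  the points of \<open>K\<close> in the slab beyond the hyperplane, hence into \<open>[x,K] - K\<close>, whose volume is at
  most \<open>t\<close>. It scales volumes by at least \<open>1 / e\<close>, so \<open>K\<close> fills at most the volume \<open>e t\<close>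
  (\<open>homothetic_copy_le_illumination\<close>).

  \<^item> The slab contains much of \<open>I\<close>: since \<open>I\<close> is star-shaped about \<open>0\<close>, the part beyond the
  hyperplane can be cut into \<open>2 d\<close> shells, each of which shrinks homothetically into the slab
  (\<open>star_shaped_shells\<close>). The scaling factors stay bounded below because the smallness of \<open>t\<close>
  forces \<open>\<eta> \<le> 1 / (2 d)\<close> (\<open>illumination_height_bound\<close>).

  Together these two facts bound the volume beyond the hyperplane by \<open>8 d\<close> times the sum of \<open>e t\<close>
  and the volume of \<open>P - K\<close> in the cone (\<open>volume_beyond_hyperplane\<close>). Summed over at most \<open>n\<close>
  cones, the terms with \<open>t\<close> contribute at most \<open>8 e d t n\<close>, which by the upper bound on \<open>n\<close> is at most a
  quarter of \<open>vol (I - K)\<close> and can be absorbed on the left-hand side.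
\<close>

section \<open>Homotheties and Lebesgue measure\<close>

lemma vol_homothety:
  fixes S :: "(real ^ 'd) set"
  assumes "m \<ge> 0"
  shows "vol ((\<lambda>y. m *\<^sub>R y + v) ` S) = m ^ CARD('d) * vol S"
  using measure_lebesgue_affine[of m v S] assms by simp

lemma lmeasurable_homothety:
  fixes S :: "(real ^ 'd) set"
  assumes "S \<in> lmeasurable" and "m \<noteq> 0"
  shows "(\<lambda>y. m *\<^sub>R y + v) ` S \<in> lmeasurable"
proof (rule fmeasurableI)
  have "(\<lambda>y. m *\<^sub>R y) ` S = (*\<^sub>R) (1 / m) -` S \<inter> space lebesgue"
    using assms(2) by (force simp: image_iff)
  also have "\<dots> \<in> sets lebesgue"
    using assms(1) by (intro measurable_sets[OF lebesgue_measurable_scaling]) auto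
  finally have "(+) v ` (\<lambda>y. m *\<^sub>R y) ` S \<in> sets lebesgue"
    by (rule lebesgue_sets_translation)
  then show "(\<lambda>y. m *\<^sub>R y + v) ` S \<in> sets lebesgue"
    by (simp add: image_image add.commute)
  show "emeasure lebesgue ((\<lambda>y. m *\<^sub>R y + v) ` S) < \<infinity>"
    using assms(1) unfolding emeasure_lebesgue_affine
    by (auto simp: fmeasurable_def ennreal_mult_less_top)
qed

section \<open>Facet inequalities of a polytope\<close>

text \<open>
  A point outside \<open>P\<close> is separated from \<open>P\<close> by the facet through which the segment from \<open>0\<close> to
  the point leaves \<open>P\<close>. Since \<open>0\<close> is an interior point, the right-hand sides of the facet
  inequalities are positive and can be normalised to 1. The functionals are indexed by numbers
  so that ties between facets can be broken later.
\<close>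

lemma polytope_as_facet_inequalities:
  fixes P :: "'a::euclidean_space set"
  assumes "polytope P" and "0 \<in> interior P"
  obtains a :: "nat \<Rightarrow> 'a"
  where "P = {x. \<forall>i < card {F. F face_of P \<and> aff_dim F = int DIM('a) - 1}. a i \<bullet> x \<le> 1}"
proof -
  define \<F> where "\<F> = {F. F face_of P \<and> aff_dim F = int DIM('a) - 1}"
  have dimP: "aff_dim P = int DIM('a)"
    using assms(2) by (intro aff_dim_nonempty_interior) auto
  have poly: "polyhedron P"
    using assms(1) by (simp add: polytope_imp_polyhedron)
  have "finite \<F>"
    using finite_polytope_faces[OF assms(1)] unfolding \<F>_def by (rule rev_finite_subset) auto
  then obtain h where h: "bij_betw h {0..<card \<F>} \<F>"
    using ex_bij_betw_nat_finite by blast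
  have "\<exists>a. P \<subseteq> {x. a \<bullet> x \<le> 1} \<and> F \<subseteq> {x. a \<bullet> x = 1}" if "F \<in> \<F>" for F
  proof -
    have F: "F face_of P" "aff_dim F = int DIM('a) - 1" using that by (auto simp: \<F>_def)
    then have "F \<noteq> {}" "F \<noteq> P" using dimP DIM_positive[where 'a = 'a] by auto
    then obtain a b where ab: "a \<noteq> 0" "P \<subseteq> {x. a \<bullet> x \<le> b}" "F = P \<inter> {x. a \<bullet> x = b}"
      using exposed_face_of_polyhedron[OF poly, of F] F(1) unfolding exposed_face_of by blast
    \<comment> \<open>A small positive multiple of \<open>a\<close> lies in \<open>P\<close>, which forces \<open>b > 0\<close>.\<close>
    obtain e where e: "e > 0" "cball 0 e \<subseteq> P"
      using assms(2) by (meson mem_interior_cball)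
    have "(e / norm a) *\<^sub>R a \<in> cball 0 e" using e ab(1) by simp
    then have "a \<bullet> ((e / norm a) *\<^sub>R a) \<le> b" using e ab by blast
    moreover have "a \<bullet> ((e / norm a) *\<^sub>R a) > 0" using e ab(1) by simp
    ultimately have "b > 0" by linarith
    then have "P \<subseteq> {x. (a /\<^sub>R b) \<bullet> x \<le> 1} \<and> F \<subseteq> {x. (a /\<^sub>R b) \<bullet> x = 1}"
      using ab by (auto simp: field_simps)
    then show ?thesis by blast
  qed
  then obtain g where g: "\<And>F. F \<in> \<F> \<Longrightarrow> P \<subseteq> {x. g F \<bullet> x \<le> 1} \<and> F \<subseteq> {x. g F \<bullet> x = 1}"
    by metis
  have "x \<in> P" if x: "\<forall>i < card \<F>. g (h i) \<bullet> x \<le> 1" for x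
  proof (rule ccontr)
    assume "x \<notin> P"
    then have "x \<noteq> 0" using assms(2) interior_subset by blast
    then obtain s where s: "s > 0" "s *\<^sub>R x \<in> frontier P"
      "\<And>e. 0 \<le> e \<Longrightarrow> e < s \<Longrightarrow> e *\<^sub>R x \<in> interior P"
      using ray_to_frontier[OF polytope_imp_bounded[OF assms(1)] assms(2)]
      by (metis add_0)
    have "s *\<^sub>R x \<in> P"
      using s(2) polytope_imp_closed[OF assms(1)] by (simp add: frontier_def)
    then have "s \<noteq> 1" using \<open>x \<notin> P\<close> by auto
    moreover have "\<not> s > 1" using s(3)[of 1] \<open>x \<notin> P\<close> interior_subset by auto
    ultimately have "s < 1" by linarith
    have "s *\<^sub>R x \<in> P - rel_interior P"
      using s(2) \<open>s *\<^sub>R x \<in> P\<close> assms(2)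
      by (metis DiffD2 DiffI empty_iff frontier_def rel_interior_nonempty_interior)
    then obtain F where F: "F facet_of P" "s *\<^sub>R x \<in> F"
      using rel_boundary_of_polyhedron[OF poly] by blast
    then have "F \<in> \<F>" using dimP by (simp add: \<F>_def facet_of_def)
    then obtain i where i: "i < card \<F>" "h i = F"
      using h by (metis atLeastLessThan_iff bij_betw_iff_bijections)
    have "g F \<bullet> (s *\<^sub>R x) = 1" using g[OF \<open>F \<in> \<F>\<close>] F(2) by blast
    moreover have "s * (g F \<bullet> x) \<le> s" using x i s(1) by (metis mult_left_le less_imp_le)
    ultimately show False using \<open>s < 1\<close> by simp
  qed
  moreover have "g (h i) \<bullet> x \<le> 1" if "x \<in> P" "i < card \<F>" for x i
  proof -
    have "h i \<in> \<F>" using h that(2) by (auto simp: bij_betw_def)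
    with g that(1) show ?thesis by blast
  qed
  ultimately have "P = {x. \<forall>i < card \<F>. (g \<circ> h) i \<bullet> x \<le> 1}" by auto
  then show thesis using that[of "g \<circ> h"] unfolding \<F>_def by blast
qed

section \<open>Illumination bodies\<close>

lemma star_shaped_illumination_body:
  fixes K :: "(real ^ 'd) set"
  assumes "compact K" and "convex K" and "0 \<in> K"
    and x: "x \<in> illumination_body K t" and s: "0 \<le> s" "s \<le> 1"
  shows "s *\<^sub>R x \<in> illumination_body K t"
proof -
  have "s *\<^sub>R x + (1 - s) *\<^sub>R 0 \<in> convex hull (insert x K)"
    using s assms(3) by (intro convexD[OF convex_convex_hull] hull_inc) auto
  then have "convex hull (insert (s *\<^sub>R x) K) \<subseteq> convex hull (insert x K)"
    by (intro hull_minimal) (auto intro: hull_inc)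
  moreover have "compact (convex hull (insert y K))" for y
    using assms(1) by (intro compact_convex_hull) simp
  ultimately have "vol (convex hull (insert (s *\<^sub>R x) K) - K) \<le> vol (convex hull (insert x K) - K)"
    using assms(1)
    by (intro measure_mono_fmeasurable sets.Diff fmeasurable.Diff fmeasurableD lmeasurable_compact) auto
  with x show ?thesis by (simp add: illumination_body_def)
qed

text \<open>
  This is the source of all volume bounds in terms of \<open>t\<close>: a homothetic copy of a part of \<open>K\<close>, contracted
  towards a point \<open>x\<close> of the illumination body, stays in \<open>[x,K]\<close>; if it lies beyond a hyperplane
  that bounds \<open>K\<close>, it misses \<open>K\<close>.
\<close>

lemma homothetic_copy_le_illumination:
  fixes K :: "(real ^ 'd) set"
  assumes "compact K" and "K \<subseteq> {y. a \<bullet> y \<le> 1}"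
    and "S \<in> lmeasurable" and "S \<subseteq> K" and m: "0 < m" "m \<le> 1"
    and above: "\<And>y. y \<in> S \<Longrightarrow> m * (a \<bullet> y) + (1 - m) * (a \<bullet> x) > 1"
    and x: "x \<in> illumination_body K t"
  shows "m ^ CARD('d) * vol S \<le> t"
proof -
  let ?T = "(\<lambda>y. m *\<^sub>R y + (1 - m) *\<^sub>R x) ` S"
  have "m *\<^sub>R y + (1 - m) *\<^sub>R x \<in> convex hull (insert x K)" if "y \<in> S" for y
    using m assms(4) that by (intro convexD[OF convex_convex_hull] hull_inc) auto
  moreover have "m *\<^sub>R y + (1 - m) *\<^sub>R x \<notin> K" if "y \<in> S" for y
    using above[OF that] assms(2) by (force simp: inner_add_right)
  ultimately have "?T \<subseteq> convex hull (insert x K) - K" by blast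
  moreover have "compact (convex hull (insert x K))"
    using assms(1) by (intro compact_convex_hull) simp
  ultimately have "vol ?T \<le> vol (convex hull (insert x K) - K)"
    using assms(1) lmeasurable_homothety[OF assms(3)] m
    by (intro measure_mono_fmeasurable fmeasurable.Diff) (auto intro: fmeasurableD lmeasurable_compact)
  also have "\<dots> \<le> t" using x by (simp add: illumination_body_def)
  finally show ?thesis using vol_homothety m(1) by (metis less_imp_le)
qed

text \<open>
  If \<open>x\<close> were higher above the hyperplane than \<open>1 / (2 d)\<close>, then the ball inside \<open>K\<close>, contracted
  towards \<open>x\<close> with ratio \<open>1 / (4 d + 1) \<ge> 1 / (5 d)\<close>, would lie beyond the hyperplane. As the ball
  has at least the fraction \<open>(c1 c2) ^ (- d)\<close> of the volume of \<open>K\<close>, the copy would be too large for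
  the upper bound on \<open>t\<close>.
\<close>

lemma illumination_height_bound:
  fixes K :: "(real ^ 'd) set"
  assumes "compact K" and c: "c1 > 0" "c2 > 0"
    and "cball 0 (1 / c1) \<subseteq> K" and "K \<subseteq> cball 0 c2"
    and t: "t \<le> (5 * c1 * c2 * real CARD('d)) powi (- int CARD('d) - 1) * vol K"
    and a: "K \<subseteq> {y. a \<bullet> y \<le> 1}"
    and x: "x \<in> illumination_body K t"
  shows "a \<bullet> x - 1 \<le> 1 / (2 * real CARD('d))"
proof (rule ccontr)
  assume too_high: "\<not> a \<bullet> x - 1 \<le> 1 / (2 * real CARD('d))"
  define d where "d = real CARD('d)"
  have d: "d \<ge> 1" by (simp add: d_def Suc_leI)
  have vol_pos: "vol K > 0"
  proof -
    have "0 < vol (cball 0 (1 / c1) :: (real ^ 'd) set)"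
      using c by (simp add: content_cball_pos)
    also have "\<dots> \<le> vol K"
      using assms by (intro measure_mono_fmeasurable) (auto intro: fmeasurableD lmeasurable_compact)
    finally show ?thesis .
  qed
  have high: "a \<bullet> x > 1 + 1 / (2 * d)" using too_high by (simp add: d_def)
  \<comment> \<open>The ratio for which points with \<open>a \<bullet> y = - 1\<close>, the lowest possible value on the ball, reach
    the hyperplane from the height \<open>1 / (2 d)\<close>.\<close>
  define m where "m = 1 / (4 * d + 1)"
  have m: "0 < m" "m \<le> 1" using d by (auto simp: m_def)
  have above: "m * (a \<bullet> y) + (1 - m) * (a \<bullet> x) > 1" if "y \<in> cball 0 (1 / c1)" for y
  proof -
    have "- y \<in> cball 0 (1 / c1)" using that by simp
    then have "a \<bullet> (- y) \<le> 1" using a assms(4) by blast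
    then have "a \<bullet> y \<ge> - 1" by simp
    then have "m * (a \<bullet> y) \<ge> - m" using m(1) mult_left_mono[of "-1" "a \<bullet> y" m] by simp
    moreover have "(1 - m) * (a \<bullet> x) > (1 - m) * (1 + 1 / (2 * d))"
      using high d by (intro mult_strict_left_mono) (auto simp: m_def)
    moreover have "- m + (1 - m) * (1 + 1 / (2 * d)) = 1"
    proof -
      have "m * (2 + 1 / (2 * d)) = 1 / (2 * d)"
        using d by (simp add: m_def divide_simps)
      moreover have "- m + (1 - m) * (1 + 1 / (2 * d)) = 1 + 1 / (2 * d) - m * (2 + 1 / (2 * d))"
        by (simp only: algebra_simps)
      ultimately show ?thesis by linarith
    qed
    ultimately show ?thesis by linarith
  qed
  have "m ^ CARD('d) * vol (cball 0 (1 / c1) :: (real ^ 'd) set) \<le> t"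
    by (rule homothetic_copy_le_illumination[OF assms(1) a _ assms(4) _ _ above x]) (use m in auto)
  moreover have "vol K \<le> (c1 * c2) ^ CARD('d) * vol (cball 0 (1 / c1) :: (real ^ 'd) set)"
  proof -
    have "vol K \<le> vol (cball 0 c2 :: (real ^ 'd) set)"
      using assms by (intro measure_mono_fmeasurable) (auto intro: fmeasurableD lmeasurable_compact)
    also have "cball 0 c2 = (\<lambda>y. (c1 * c2) *\<^sub>R y + 0) ` (cball 0 (1 / c1) :: (real ^ 'd) set)"
      using c cball_scale[of "c1 * c2" "0 :: real ^ 'd" "1 / c1"] by (simp add: field_simps)
    also have "vol \<dots> = (c1 * c2) ^ CARD('d) * vol (cball 0 (1 / c1) :: (real ^ 'd) set)"
      using c by (subst vol_homothety) auto
    finally show ?thesis .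
  qed
  ultimately have "m ^ CARD('d) * vol K \<le> (c1 * c2) ^ CARD('d) * t"
  proof -
    assume t_ge: "m ^ CARD('d) * vol (cball 0 (1 / c1) :: (real ^ 'd) set) \<le> t"
      and K_le: "vol K \<le> (c1 * c2) ^ CARD('d) * vol (cball 0 (1 / c1) :: (real ^ 'd) set)"
    have "m ^ CARD('d) * vol K
        \<le> m ^ CARD('d) * ((c1 * c2) ^ CARD('d) * vol (cball 0 (1 / c1) :: (real ^ 'd) set))"
      using K_le m by (intro mult_left_mono) auto
    also have "\<dots> = (c1 * c2) ^ CARD('d) * (m ^ CARD('d) * vol (cball 0 (1 / c1) :: (real ^ 'd) set))"
      by simp
    also have "\<dots> \<le> (c1 * c2) ^ CARD('d) * t"
      using t_ge c by (intro mult_left_mono) auto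
    finally show ?thesis .
  qed
  then have lower: "(m / (c1 * c2)) ^ CARD('d) * vol K \<le> t"
    using c by (simp add: power_divide field_simps)
  have "cball 0 (1 / c1) \<subseteq> (cball 0 c2 :: (real ^ 'd) set)" using assms by blast
  then have "1 / c1 \<le> c2" using c by (simp add: cball_subset_cball_iff)
  then have cc: "c1 * c2 \<ge> 1" using c by (simp add: field_simps)
  define w where "w = 5 * c1 * c2 * d"
  have "c1 * c2 * d \<ge> 1" using mult_mono[OF cc d] c d by simp
  then have w: "w > 1" by (simp add: w_def)
  have "1 / w = (1 / (5 * d)) / (c1 * c2)" by (simp add: w_def)
  also have "\<dots> \<le> m / (c1 * c2)"
    using c d by (intro divide_right_mono) (auto simp: m_def field_simps)
  finally have "(1 / w) ^ CARD('d) \<le> (m / (c1 * c2)) ^ CARD('d)"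
    using w by (intro power_mono) auto
  moreover have "w powi (- int CARD('d) - 1) < (1 / w) ^ CARD('d)"
  proof -
    have "- int CARD('d) - 1 = - int (Suc CARD('d))" by simp
    then have "w powi (- int CARD('d) - 1) = (1 / w) ^ Suc CARD('d)"
      by (simp only: power_int_minus power_int_of_nat) (simp add: power_divide inverse_eq_divide)
    also have "\<dots> < (1 / w) ^ CARD('d)"
      using w by (intro power_strict_decreasing) auto
    finally show ?thesis .
  qed
  ultimately have "w powi (- int CARD('d) - 1) * vol K < (m / (c1 * c2)) ^ CARD('d) * vol K"
    using vol_pos by (intro mult_strict_right_mono) auto
  with lower t show False by (simp add: w_def d_def)
qed

section \<open>Volume beyond a single hyperplane\<close>

lemma lmeasurable_Int_slab:
  fixes U :: "(real ^ 'd) set"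
  assumes "U \<in> lmeasurable"
  shows "U \<inter> {y. l < a \<bullet> y \<and> a \<bullet> y \<le> u} \<in> lmeasurable"
proof -
  have "{y. l < a \<bullet> y} \<in> sets lebesgue" "{y. a \<bullet> y \<le> u} \<in> sets lebesgue"
    using open_halfspace_gt[of l a] closed_halfspace_le[of a u]
    by (auto intro: borel_open borel_closed sets_completionI_sets)
  then have "{y. l < a \<bullet> y \<and> a \<bullet> y \<le> u} \<in> sets lebesgue"
    using sets.Int by (simp add: Collect_conj_eq)
  then show ?thesis by (rule fmeasurable_Int_fmeasurable[OF assms])
qed

text \<open>
  The region \<open>1 < a \<bullet> y \<le> (1 / q) ^ N\<close> is the union of the shells \<open>(1 / q) ^ j < a \<bullet> y \<le> (1 / q) ^ (j + 1)\<close> for \<open>j < N\<close>.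
  Scaling by \<open>q ^ (j + 1)\<close> maps the part of \<open>U\<close> in such a shell into the slab \<open>q < a \<bullet> y \<le> 1\<close>, because
  \<open>U\<close> is star-shaped. This takes the place of an integration over the rays of a cone.
\<close>

lemma star_shaped_shells:
  fixes U :: "(real ^ 'd) set"
  assumes U: "U \<in> lmeasurable"
    and star: "\<And>y s. y \<in> U \<Longrightarrow> 0 < s \<Longrightarrow> s \<le> 1 \<Longrightarrow> s *\<^sub>R y \<in> U"
    and q: "0 < q" "q \<le> 1"
  shows "q ^ (CARD('d) * N) * vol (U \<inter> {y. 1 < a \<bullet> y \<and> a \<bullet> y \<le> (1 / q) ^ N})
    \<le> real N * vol (U \<inter> {y. q < a \<bullet> y \<and> a \<bullet> y \<le> 1})"
proof (induction N)
  case 0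
  then show ?case by (simp add: not_less Collect_conv_if flip: not_le)
next
  case (Suc N)
  let ?d = "CARD('d)"
  let ?slab = "\<lambda>l u. U \<inter> {y. l < a \<bullet> y \<and> a \<bullet> y \<le> u}"
  let ?shell = "?slab ((1 / q) ^ N) ((1 / q) ^ Suc N)"
  have scale: "(\<lambda>y. q ^ Suc N *\<^sub>R y + 0) ` ?shell \<subseteq> ?slab q 1"
  proof clarify
    fix y assume y: "y \<in> U" "(1 / q) ^ N < a \<bullet> y" "a \<bullet> y \<le> (1 / q) ^ Suc N"
    have "q ^ Suc N * (1 / q) ^ N < q ^ Suc N * (a \<bullet> y)"
      using y(2) q by (intro mult_strict_left_mono) auto
    moreover have "q ^ Suc N * (a \<bullet> y) \<le> q ^ Suc N * (1 / q) ^ Suc N"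
      using y(3) q by (intro mult_left_mono) auto
    moreover have "q ^ Suc N * (1 / q) ^ N = q" "q ^ Suc N * (1 / q) ^ Suc N = 1"
      using q by (simp_all add: power_divide)
    moreover have "q ^ Suc N \<le> 1" using q by (intro power_le_one) auto
    ultimately show "q ^ Suc N *\<^sub>R y + 0 \<in> ?slab q 1"
      using star[OF y(1), of "q ^ Suc N"] q by (simp del: power_Suc)
  qed
  have "vol ((\<lambda>y. q ^ Suc N *\<^sub>R y + 0) ` ?shell) \<le> vol (?slab q 1)"
    using scale U q
    by (intro measure_mono_fmeasurable lmeasurable_Int_slab fmeasurableD[OF lmeasurable_homothety]) auto
  then have shell: "q ^ (?d * Suc N) * vol ?shell \<le> vol (?slab q 1)"
  proof -
    have "q ^ (?d * Suc N) = (q ^ Suc N) ^ ?d" by (metis mult.commute power_mult)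
    with \<open>vol (_ ` ?shell) \<le> _\<close> q show ?thesis
      by (subst (asm) vol_homothety) (simp_all del: power_Suc)
  qed
  have "?slab 1 ((1 / q) ^ Suc N) \<subseteq> ?slab 1 ((1 / q) ^ N) \<union> ?shell" by auto
  then have "vol (?slab 1 ((1 / q) ^ Suc N)) \<le> vol (?slab 1 ((1 / q) ^ N) \<union> ?shell)"
    using U by (intro measure_mono_fmeasurable fmeasurable.Un lmeasurable_Int_slab)
      (auto intro: fmeasurableD lmeasurable_Int_slab)
  also have "\<dots> \<le> vol (?slab 1 ((1 / q) ^ N)) + vol ?shell"
    using U by (intro measure_Un_le fmeasurableD lmeasurable_Int_slab)
  finally have "q ^ (?d * Suc N) * vol (?slab 1 ((1 / q) ^ Suc N))
      \<le> q ^ (?d * Suc N) * (vol (?slab 1 ((1 / q) ^ N)) + vol ?shell)"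
    using q by (intro mult_left_mono) auto
  also have "\<dots> \<le> q ^ (?d * N) * vol (?slab 1 ((1 / q) ^ N)) + q ^ (?d * Suc N) * vol ?shell"
    using q by (auto simp: distrib_left intro!: mult_right_mono power_decreasing)
  also have "\<dots> \<le> real (Suc N) * vol (?slab q 1)"
    using Suc shell by (simp add: distrib_right)
  finally show ?case .
qed

text \<open>
  This is the comparison described at the beginning, for one functional \<open>a\<close>. The set \<open>U\<close> stands
  for the part of the illumination body in the cone of one facet.
\<close>

lemma volume_beyond_hyperplane:
  fixes K U :: "(real ^ 'd) set" and d :: real
  defines "d \<equiv> real CARD('d)"
  assumes d2: "CARD('d) \<ge> 2"
    and "compact K" and aK: "K \<subseteq> {y. a \<bullet> y \<le> 1}"
    and U: "U \<in> lmeasurable" "U \<subseteq> illumination_body K t" and "0 \<le> t"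
    and star: "\<And>y s. y \<in> U \<Longrightarrow> 0 < s \<Longrightarrow> s \<le> 1 \<Longrightarrow> s *\<^sub>R y \<in> U"
    and height: "\<And>x. x \<in> U \<Longrightarrow> a \<bullet> x - 1 \<le> 1 / (2 * d)"
  shows "vol (U \<inter> {y. 1 < a \<bullet> y}) \<le> 8 * d * (vol (U \<inter> {y. a \<bullet> y \<le> 1} - K) + exp 1 * t)"
proof (cases "U \<inter> {y. 1 < a \<bullet> y} = {}")
  case True
  then show ?thesis using \<open>0 \<le> t\<close> by (simp add: d_def)
next
  case False
  have d: "d \<ge> 2" using d2 by (simp add: d_def)
  define H where "H = (\<lambda>x. a \<bullet> x - 1) ` (U \<inter> {y. 1 < a \<bullet> y})"
  have H: "H \<noteq> {}" "bdd_above H"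
    using False height unfolding H_def by (auto intro!: bdd_aboveI)
  have "Sup H > 0"
    using False H(2) unfolding H_def by (force simp: less_cSup_iff)
  then have "Sup H / 2 < Sup H" by simp
  then obtain h where "h \<in> H" "Sup H / 2 < h"
    using less_cSupE[OF _ H(1)] by blast
  then obtain x where x: "x \<in> U" "1 < a \<bullet> x" "Sup H < 2 * (a \<bullet> x - 1)"
    unfolding H_def by auto
  define \<eta> where "\<eta> = a \<bullet> x - 1"
  have \<eta>: "0 < \<eta>" "\<eta> \<le> 1 / (2 * d)" using x height by (auto simp: \<eta>_def)
  have top: "a \<bullet> y \<le> 1 + 2 * \<eta>" if "y \<in> U" for y
  proof (cases "1 < a \<bullet> y")
    case True
    then have "a \<bullet> y - 1 \<le> Sup H" using that H by (intro cSup_upper) (auto simp: H_def)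
    then show ?thesis using x by (simp add: \<eta>_def)
  qed (use \<eta> in simp)
  \<comment> \<open>The thickness \<open>\<eta> / d\<close> is the largest, up to a constant factor, for which the homothety
    towards \<open>x\<close> that lifts the slab beyond the hyperplane shrinks volumes only by a constant.\<close>
  define q where "q = 1 - \<eta> / d"
  have dsq: "d\<^sup>2 * (\<eta> / d) \<le> 1 / 2"
  proof -
    have "d\<^sup>2 * (\<eta> / d) = d * \<eta>" using d by (simp add: power2_eq_square)
    also have "\<dots> \<le> 1 / 2" using \<eta> d by (simp add: field_simps)
    finally show ?thesis .
  qed
  have eta1: "\<eta> / d \<le> 1 / 8"
  proof -
    have "4 * (\<eta> / d) \<le> d\<^sup>2 * (\<eta> / d)"
      using \<eta> d by (intro mult_right_mono) (auto simp: power2_eq_square intro: mult_mono[of 2 d 2 d, simplified])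
    with dsq show ?thesis by linarith
  qed
  have q: "0 < q" "q < 1" using eta1 \<eta> d by (auto simp: q_def)
  let ?slab = "\<lambda>l u. {y. l < a \<bullet> y \<and> a \<bullet> y \<le> u}"
  \<comment> \<open>The total shrinking over \<open>2 d\<close> shells. Bernoulli's inequality for the exponent \<open>2 d\<^sup>2\<close> itself
    would only give the trivial lower bound 0, hence the square.\<close>
  have qpow: "1 / 4 \<le> q ^ (CARD('d) * (2 * CARD('d)))"
  proof -
    have "1 / 2 \<le> 1 + real (CARD('d)\<^sup>2) * (- (\<eta> / d))" using dsq by (simp add: d_def)
    also have "\<dots> \<le> (1 + (- (\<eta> / d))) ^ (CARD('d)\<^sup>2)"
      using eta1 by (intro Bernoulli_inequality) linarith
    also have "\<dots> = q ^ (CARD('d)\<^sup>2)" by (simp add: q_def)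
    finally have "(1 / 2)\<^sup>2 \<le> (q ^ (CARD('d)\<^sup>2))\<^sup>2" by (intro power_mono) auto
    also have "\<dots> = q ^ (CARD('d) * (2 * CARD('d)))"
    proof -
      have "CARD('d)\<^sup>2 * 2 = CARD('d) * (2 * CARD('d))" by (simp add: power2_eq_square)
      then show ?thesis by (metis power_mult)
    qed
    finally show ?thesis by (simp add: power2_eq_square)
  qed
  \<comment> \<open>The \<open>2 d\<close> shells cover all of \<open>U\<close> beyond the hyperplane.\<close>
  have reach: "1 + 2 * \<eta> \<le> (1 / q) ^ (2 * CARD('d))"
  proof -
    have pos: "0 \<le> \<eta> / d" using \<eta> d by simp
    have "1 + 2 * \<eta> = 1 + real (2 * CARD('d)) * (\<eta> / d)" using d by (simp add: d_def)
    also have "\<dots> \<le> (1 + \<eta> / d) ^ (2 * CARD('d))"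
      using pos by (intro Bernoulli_inequality) linarith
    also have "\<dots> \<le> (1 / q) ^ (2 * CARD('d))"
    proof (intro power_mono)
      have "(1 + \<eta> / d) * q = 1 - (\<eta> / d)\<^sup>2" by (simp add: q_def power2_eq_square algebra_simps)
      also have "\<dots> \<le> 1" by simp
      finally show "1 + \<eta> / d \<le> 1 / q" using q by (simp add: field_simps)
    qed (use pos in linarith)
    finally show ?thesis .
  qed
  have "a \<bullet> y \<le> (1 / q) ^ (2 * CARD('d))" if "y \<in> U" for y
    using top[OF that] reach by linarith
  then have all: "U \<inter> {y. 1 < a \<bullet> y} = U \<inter> ?slab 1 ((1 / q) ^ (2 * CARD('d)))"
    by blast
  have "1 / 4 * vol (U \<inter> {y. 1 < a \<bullet> y})
      \<le> q ^ (CARD('d) * (2 * CARD('d))) * vol (U \<inter> ?slab 1 ((1 / q) ^ (2 * CARD('d))))"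
    unfolding all by (rule mult_right_mono[OF qpow measure_nonneg])
  also have "\<dots> \<le> 2 * d * vol (U \<inter> ?slab q 1)"
    using star_shaped_shells[OF U(1) star, of q "2 * CARD('d)" a] q by (simp add: d_def)
  finally have beyond: "vol (U \<inter> {y. 1 < a \<bullet> y}) \<le> 8 * d * vol (U \<inter> ?slab q 1)" by simp
  have KS: "K \<inter> ?slab q 1 \<in> lmeasurable"
    using assms by (intro lmeasurable_Int_slab lmeasurable_compact)
  have "vol (K \<inter> ?slab q 1) \<le> exp 1 * t"
  proof -
    \<comment> \<open>The ratio for which a point at depth \<open>\<eta> / d\<close> is lifted exactly to the hyperplane.\<close>
    define m where "m = 1 / (1 + 1 / d)"
    have "1 < 1 + 1 / d" using d by simp
    then have m: "0 < m" "m \<le> 1" and m_inverse: "m * (1 + 1 / d) = 1"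
      unfolding m_def by (smt (verit) divide_le_eq_1 divide_pos_pos nonzero_eq_divide_eq)+
    have "m * (a \<bullet> y) + (1 - m) * (a \<bullet> x) > 1" if "y \<in> K \<inter> ?slab q 1" for y
    proof -
      have "m * (a \<bullet> y) > m * q" using that m by (intro mult_strict_left_mono) auto
      moreover have "m * q + (1 - m) * (1 + \<eta>) = 1"
      proof -
        have "m * q + (1 - m) * (1 + \<eta>) = 1 + \<eta> - m * (1 + 1 / d) * \<eta>"
          by (simp add: q_def algebra_simps)
        then show ?thesis using m_inverse by simp
      qed
      ultimately show ?thesis by (simp add: \<eta>_def)
    qed
    then have "m ^ CARD('d) * vol (K \<inter> ?slab q 1) \<le> t"
      using homothetic_copy_le_illumination[OF \<open>compact K\<close> aK KS _ m] x(1) U(2) by blast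
    then have "vol (K \<inter> ?slab q 1) \<le> (1 + 1 / d) ^ CARD('d) * t"
    proof -
      assume scaled: "m ^ CARD('d) * vol (K \<inter> ?slab q 1) \<le> t"
      have "vol (K \<inter> ?slab q 1) = (1 + 1 / d) ^ CARD('d) * (m ^ CARD('d) * vol (K \<inter> ?slab q 1))"
        using m_inverse by (simp add: power_mult_distrib[symmetric] mult.commute flip: mult.assoc)
      also have "\<dots> \<le> (1 + 1 / d) ^ CARD('d) * t"
        using scaled d by (intro mult_left_mono) auto
      finally show ?thesis .
    qed
    also have "\<dots> \<le> exp 1 * t"
      using exp_ge_one_plus_x_over_n_power_n[of "CARD('d)" 1] \<open>0 \<le> t\<close>
      by (intro mult_right_mono) (auto simp: d_def)
    finally show ?thesis .
  qed
  moreover have "vol (U \<inter> ?slab q 1) \<le> vol (U \<inter> {y. a \<bullet> y \<le> 1} - K) + vol (K \<inter> ?slab q 1)"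
  proof -
    have "U \<inter> {y. a \<bullet> y \<le> 1} \<in> lmeasurable"
      using closed_halfspace_le[of a 1]
      by (intro fmeasurable_Int_fmeasurable U) (auto intro: borel_closed sets_completionI_sets)
    then have B: "U \<inter> {y. a \<bullet> y \<le> 1} - K \<in> lmeasurable"
      by (rule fmeasurable.Diff[OF _ lmeasurable_compact[OF \<open>compact K\<close>]])
    have "vol (U \<inter> ?slab q 1) \<le> vol ((U \<inter> {y. a \<bullet> y \<le> 1} - K) \<union> (K \<inter> ?slab q 1))"
      using B KS U(1) by (intro measure_mono_fmeasurable fmeasurable.Un)
        (auto intro: fmeasurableD lmeasurable_Int_slab)
    also have "\<dots> \<le> vol (U \<inter> {y. a \<bullet> y \<le> 1} - K) + vol (K \<inter> ?slab q 1)"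
      using B KS by (intro measure_Un_le fmeasurableD)
    finally show ?thesis .
  qed
  ultimately have "vol (U \<inter> ?slab q 1) \<le> vol (U \<inter> {y. a \<bullet> y \<le> 1} - K) + exp 1 * t"
    by linarith
  then have "8 * d * vol (U \<inter> ?slab q 1)
      \<le> 8 * d * (vol (U \<inter> {y. a \<bullet> y \<le> 1} - K) + exp 1 * t)"
    using d by (intro mult_left_mono) auto
  with beyond show ?thesis by linarith
qed

section \<open>Decomposition into cones over the facets\<close>

text \<open>
  Ties are broken in favour of the least index, so that the cones are disjoint. When the
  functionals define the facets of a polytope around \<open>0\<close>, this is, up to the choice on common
  boundaries, the cone spanned by the facet with index \<open>i\<close>.
\<close>

definition argmax_cone :: "(nat \<Rightarrow> 'a::real_inner) \<Rightarrow> nat \<Rightarrow> nat \<Rightarrow> 'a set" where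
  "argmax_cone a m i =
     {x. (\<forall>j<m. a j \<bullet> x \<le> a i \<bullet> x) \<and> (\<forall>j<i. a j \<bullet> x < a i \<bullet> x)}"

lemma argmax_cone_scale:
  assumes "x \<in> argmax_cone a m i" and "0 < s"
  shows "s *\<^sub>R x \<in> argmax_cone a m i"
  using assms by (simp add: argmax_cone_def)

lemma argmax_cone_sets_lebesgue:
  fixes a :: "nat \<Rightarrow> 'a::euclidean_space"
  shows "argmax_cone a m i \<in> sets lebesgue"
proof -
  have "argmax_cone a m i =
      (\<Inter>j\<in>{..<m}. {x. a j \<bullet> x \<le> a i \<bullet> x}) \<inter> (\<Inter>j\<in>{..<i}. {x. a j \<bullet> x < a i \<bullet> x})"
    by (auto simp: argmax_cone_def)
  moreover have "closed (\<Inter>j\<in>{..<m}. {x. a j \<bullet> x \<le> a i \<bullet> x})"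
    by (intro closed_INT ballI closed_Collect_le continuous_intros)
  moreover have "open (\<Inter>j\<in>{..<i}. {x. a j \<bullet> x < a i \<bullet> x})"
    by (intro open_INT ballI open_Collect_less continuous_intros) auto
  ultimately have "argmax_cone a m i \<in> sets borel"
    by (simp add: borel_closed borel_open sets.Int)
  then show ?thesis by (simp add: sets_completionI_sets)
qed

lemma argmax_cone_disjnt:
  assumes "i < m" "j < m" "i \<noteq> j"
  shows "disjnt (argmax_cone a m i) (argmax_cone a m j)"
proof -
  have "False" if "x \<in> argmax_cone a m i" "x \<in> argmax_cone a m j" for x
    using that assms unfolding argmax_cone_def by (metis (mono_tags, lifting) linorder_neqE_nat mem_Collect_eq not_le)
  then show ?thesis by (auto simp: disjnt_def)
qed

lemma argmax_cone_exists:
  assumes "m > 0"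
  shows "\<exists>i<m. x \<in> argmax_cone a m i"
proof -
  define M where "M = Max ((\<lambda>j. a j \<bullet> x) ` {..<m})"
  have M: "a j \<bullet> x \<le> M" if "j < m" for j
    unfolding M_def using that by (intro Max_ge) auto
  have "M \<in> (\<lambda>j. a j \<bullet> x) ` {..<m}"
    unfolding M_def using assms by (intro Max_in) auto
  then have ex: "\<exists>i. i < m \<and> a i \<bullet> x = M" by auto
  define i where "i = (LEAST i. i < m \<and> a i \<bullet> x = M)"
  have i: "i < m" "a i \<bullet> x = M" using LeastI_ex[OF ex] by (auto simp: i_def)
  have "a j \<bullet> x < M" if "j < i" for j
  proof -
    have "a j \<bullet> x \<noteq> M"
      using not_less_Least[of j "\<lambda>i. i < m \<and> a i \<bullet> x = M"] that i(1) by (auto simp: i_def)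
    with M[of j] that i(1) show ?thesis by simp
  qed
  then have "x \<in> argmax_cone a m i" using i M by (auto simp: argmax_cone_def)
  then show ?thesis using i by blast
qed

text \<open>
  In the cone with index \<open>i\<close>, a point belongs to \<open>P\<close> if and only if it satisfies the inequality
  with index \<open>i\<close>, so the single-hyperplane estimate applies there. The cones are disjoint, hence
  the volumes of \<open>P - K\<close> in them add up to at most \<open>vol (P - K)\<close>.
\<close>

lemma illumination_volume_outside_polytope:
  fixes K P :: "(real ^ 'd) set" and d :: real and a :: "nat \<Rightarrow> real ^ 'd"
  defines "d \<equiv> real CARD('d)"
  assumes d2: "CARD('d) \<ge> 2"
    and K: "compact K" "convex K" "0 \<in> K" and "K \<subseteq> P" and "P \<in> lmeasurable"
    and P: "P = {x. \<forall>i<m. a i \<bullet> x \<le> 1}"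
    and I: "illumination_body K t \<in> lmeasurable" and "0 \<le> t"
    and height: "\<And>x b. x \<in> illumination_body K t \<Longrightarrow> K \<subseteq> {y. b \<bullet> y \<le> 1} \<Longrightarrow> b \<bullet> x - 1 \<le> 1 / (2 * d)"
  shows "vol (illumination_body K t - P) \<le> 8 * d * (vol (P - K) + real m * (exp 1 * t))"
proof -
  let ?I = "illumination_body K t" and ?C = "argmax_cone a m"
  have U: "?I \<inter> ?C i \<in> lmeasurable" for i
    by (intro fmeasurable_Int_fmeasurable I argmax_cone_sets_lebesgue)
  have PK: "P - K \<in> lmeasurable"
    using \<open>P \<in> lmeasurable\<close> K(1) by (intro fmeasurable.Diff) (auto intro: lmeasurable_compact)
  then have B: "?C i \<inter> (P - K) \<in> lmeasurable" for i
    using fmeasurable_Int_fmeasurable[OF PK argmax_cone_sets_lebesgue] by (simp add: Int_commute)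
  have above: "?I \<inter> ?C i \<inter> {y. 1 < a i \<bullet> y} \<in> sets lebesgue" for i
    using open_halfspace_gt[of 1 "a i"] U[of i]
    by (intro sets.Int fmeasurableD[OF U[of i]]) (auto intro: borel_open sets_completionI_sets)
  have one: "vol (?I \<inter> ?C i \<inter> {y. 1 < a i \<bullet> y}) \<le> 8 * d * (vol (?C i \<inter> (P - K)) + exp 1 * t)"
    if i: "i < m" for i
  proof -
    have aK: "K \<subseteq> {y. a i \<bullet> y \<le> 1}" using \<open>K \<subseteq> P\<close> P i by auto
    have "s *\<^sub>R y \<in> ?I \<inter> ?C i" if "y \<in> ?I \<inter> ?C i" "0 < s" "s \<le> 1" for y s
      using that star_shaped_illumination_body[OF K] argmax_cone_scale by auto
    then have "vol (?I \<inter> ?C i \<inter> {y. 1 < a i \<bullet> y})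
        \<le> 8 * d * (vol (?I \<inter> ?C i \<inter> {y. a i \<bullet> y \<le> 1} - K) + exp 1 * t)"
      using d2 K(1) aK U \<open>0 \<le> t\<close> height[OF _ aK] unfolding d_def
      by (intro volume_beyond_hyperplane) auto
    also have "vol (?I \<inter> ?C i \<inter> {y. a i \<bullet> y \<le> 1} - K) \<le> vol (?C i \<inter> (P - K))"
    proof (intro measure_mono_fmeasurable B)
      show "?I \<inter> ?C i \<inter> {y. a i \<bullet> y \<le> 1} - K \<subseteq> ?C i \<inter> (P - K)"
        by (auto simp: P argmax_cone_def intro: order_trans)
      show "?I \<inter> ?C i \<inter> {y. a i \<bullet> y \<le> 1} - K \<in> sets lebesgue"
        using closed_halfspace_le[of "a i" 1] K(1)
        by (intro sets.Diff sets.Int[OF fmeasurableD[OF U]] fmeasurableD[OF lmeasurable_compact[OF K(1)]])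
          (auto intro: borel_closed sets_completionI_sets)
    qed
    finally show ?thesis by (simp add: d_def mult_left_mono)
  qed
  have "?I - P \<subseteq> (\<Union>i<m. ?I \<inter> ?C i \<inter> {y. 1 < a i \<bullet> y})"
  proof
    fix x assume x: "x \<in> ?I - P"
    then obtain j where j: "j < m" "1 < a j \<bullet> x" by (auto simp: P not_le)
    then obtain i where i: "i < m" "x \<in> ?C i" using argmax_cone_exists[of m x a] by auto
    then have "1 < a i \<bullet> x" using j by (force simp: argmax_cone_def)
    then show "x \<in> (\<Union>i<m. ?I \<inter> ?C i \<inter> {y. 1 < a i \<bullet> y})" using x i by auto
  qed
  then have "vol (?I - P) \<le> vol (\<Union>i<m. ?I \<inter> ?C i \<inter> {y. 1 < a i \<bullet> y})"
    using I \<open>P \<in> lmeasurable\<close> above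
    by (intro measure_mono_fmeasurable fmeasurableD[OF fmeasurable.Diff] fmeasurable_UN[where A = ?I])
      (auto simp: countable_finite)
  also have "\<dots> \<le> (\<Sum>i<m. vol (?I \<inter> ?C i \<inter> {y. 1 < a i \<bullet> y}))"
    using above by (intro measure_UNION_le) auto
  also have "\<dots> \<le> (\<Sum>i<m. 8 * d * (vol (?C i \<inter> (P - K)) + exp 1 * t))"
    using one by (intro sum_mono) auto
  also have "\<dots> = 8 * d * ((\<Sum>i<m. vol (?C i \<inter> (P - K))) + real m * (exp 1 * t))"
    by (simp add: sum.distrib distrib_left flip: sum_distrib_left)
  also have "(\<Sum>i<m. vol (?C i \<inter> (P - K))) = vol (\<Union>i<m. ?C i \<inter> (P - K))"
    using B argmax_cone_disjnt[of _ m _ a]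
    by (intro measure_UNION'[symmetric]) (auto simp: pairwise_def disjnt_def)
  also have "\<dots> \<le> vol (P - K)"
    using PK B by (intro measure_mono_fmeasurable sets.finite_UN fmeasurableD) auto
  finally show ?thesis by (simp add: d_def)
qed

section \<open>Approximation by circumscribed polytopes\<close>

theorem theorem3p1:
  fixes K P :: "(real ^ 'd) set" and c1 c2 t :: real and n :: nat
  assumes "CARD('d) \<ge> 2"
    and "c1 > 0" and "c2 > 0"
    and "convex_body K"
    and "cball 0 (1 / c1) \<subseteq> K" and "K \<subseteq> cball 0 c2"
    and "0 < t"
    and "t \<le> (5 * c1 * c2 * real CARD('d)) powi (- int CARD('d) - 1) * vol K"
    and "(128 / 7 * pi) powr ((real CARD('d) - 1) / 2) \<le> real n"
    and "real n \<le> 1 / (32 * exp 1 * real CARD('d) * t) * vol (illumination_body K t - K)"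
    and "polytope P" and "K \<subseteq> P"
    and "card {F. F face_of P \<and> aff_dim F = int CARD('d) - 1} \<le> n"
  shows "vol (illumination_body K t - K)
    \<le> 10 ^ 7 * (real CARD('d))\<^sup>2 * (c1 * c2) powr (2 + 1 / (real CARD('d) - 1)) * vol (P - K)"
proof (cases "illumination_body K t - K \<in> lmeasurable")
  case False
  \<comment> \<open>The measure of such a set is 0 by the default values of \<open>measure\<close>.\<close>
  let ?I = "illumination_body K t"
  have "vol (?I - K) = 0"
    using False
    by (cases "?I - K \<in> sets lebesgue")
      (auto simp: fmeasurable_def emeasure_notin_sets measure_def less_top[symmetric])
  then show ?thesis by simp
next
  case True
  let ?I = "illumination_body K t"
  define d where "d = real CARD('d)"
  define m where "m = card {F. F face_of P \<and> aff_dim F = int CARD('d) - 1}"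
  have d: "d \<ge> 2" using assms(1) by (simp add: d_def)
  have K: "compact K" "convex K" using assms(4) by (auto simp: convex_body_def)
  have zero: "0 \<in> interior K"
    using assms(2,5) by (auto simp: mem_interior_cball intro!: exI[of _ "1 / c1"])
  then have "0 \<in> K" and zeroP: "0 \<in> interior P"
    using interior_subset interior_mono[OF assms(12)] by blast+
  obtain a where a: "P = {x. \<forall>i<m. a i \<bullet> x \<le> 1}"
    using polytope_as_facet_inequalities[OF assms(11) zeroP] unfolding m_def by auto
  have "K \<subseteq> ?I"
    using \<open>0 < t\<close> K by (auto simp: illumination_body_def insert_absorb hull_same)
  then have "?I = (?I - K) \<union> K" by blast
  then have I: "?I \<in> lmeasurable"
    using True K(1) by (metis fmeasurable.Un lmeasurable_compact)
  have P: "P \<in> lmeasurable"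
    using assms(11) by (intro lmeasurable_compact polytope_imp_compact)
  then have PK: "P - K \<in> lmeasurable"
    using lmeasurable_compact[OF K(1)] by (rule fmeasurable.Diff)
  have "vol (?I - K) \<le> vol ((P - K) \<union> (?I - P))"
    using I P
    by (intro measure_mono_fmeasurable fmeasurable.Un[OF PK] fmeasurable.Diff fmeasurableD[OF True]) auto
  also have "\<dots> \<le> vol (P - K) + vol (?I - P)"
    using I P by (intro measure_Un_le fmeasurableD[OF PK] fmeasurableD fmeasurable.Diff)
  also have "vol (?I - P) \<le> 8 * d * (vol (P - K) + real m * (exp 1 * t))"
    unfolding d_def
    using illumination_height_bound[OF K(1) assms(2,3,5,6,8)] assms(1,7,12) K \<open>0 \<in> K\<close> P a I
    by (intro illumination_volume_outside_polytope) auto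
  also have "real m * (exp 1 * t) \<le> vol (?I - K) / (32 * d)"
  proof -
    have "real m * (exp 1 * t) \<le> real n * (exp 1 * t)"
      using assms(13) \<open>0 < t\<close> by (intro mult_right_mono) (auto simp: m_def)
    also have "\<dots> \<le> (1 / (32 * exp 1 * d * t) * vol (?I - K)) * (exp 1 * t)"
      using assms(10) \<open>0 < t\<close> by (intro mult_right_mono) (auto simp: d_def)
    also have "\<dots> = vol (?I - K) / (32 * d)"
      using d \<open>0 < t\<close> by (simp add: field_simps)
    finally show ?thesis .
  qed
  finally have "vol (?I - K) \<le> vol (P - K) + 8 * d * (vol (P - K) + vol (?I - K) / (32 * d))"
    using d by simp
  also have "\<dots> = (1 + 8 * d) * vol (P - K) + vol (?I - K) / 4"
    using d by (simp add: field_simps)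
  finally have "vol (?I - K) \<le> 4 / 3 * (1 + 8 * d) * vol (P - K)"
    unfolding mult.assoc[of "4 / 3"] by linarith
  also have "\<dots> \<le> (10 ^ 7 * d\<^sup>2 * (c1 * c2) powr (2 + 1 / (d - 1))) * vol (P - K)"
  proof (intro mult_right_mono)
    have "cball 0 (1 / c1) \<subseteq> (cball 0 c2 :: (real ^ 'd) set)" using assms by blast
    then have "1 / c1 \<le> c2" using assms(2,3) by (simp add: cball_subset_cball_iff)
    then have "c1 * c2 \<ge> 1" using assms(2,3) by (simp add: field_simps)
    then have "1 \<le> (c1 * c2) powr (2 + 1 / (d - 1))"
      using d by (intro ge_one_powr_ge_zero) auto
    then have "10 ^ 7 * d\<^sup>2 * 1 \<le> 10 ^ 7 * d\<^sup>2 * (c1 * c2) powr (2 + 1 / (d - 1))"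
      by (intro mult_left_mono) auto
    moreover have "4 / 3 * (1 + 8 * d) \<le> 10 ^ 7 * d\<^sup>2"
    proof -
      have "4 / 3 * (1 + 8 * d) \<le> 12 * d" using d by (simp add: field_simps)
      also have "\<dots> \<le> 12 * d\<^sup>2" using d by (simp add: power2_eq_square)
      also have "\<dots> \<le> 10 ^ 7 * d\<^sup>2" by (intro mult_right_mono) auto
      finally show ?thesis .
    qed
    ultimately show "4 / 3 * (1 + 8 * d) \<le> 10 ^ 7 * d\<^sup>2 * (c1 * c2) powr (2 + 1 / (d - 1))"
      by linarith
  qed simp
  finally show ?thesis by (simp add: d_def)
qed

end
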